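(* $$\lim_{n\to\infty}\lambda(\mathcal{C}_n)=0,$$ where $\lambda$ denotes Lebesgue measure on $[0,1]$ and $\mathcal{C}_n$ is the $n$-th sum-level set for regular continued fractions.
   Context: For positive integers $a_1,a_2,\ldots$, $[a_1,a_2,\ldots]:=\cfrac{1}{a_1+\cfrac{1}{a_2+\cdots}}$ denotes the regular continued fraction with these entries; Lebesgue-almost every $x\in[0,1]$ (every irrational) has a unique such infinite expansion. For $n\in\mathbb{N}=\{1,2,\ldots\}$ the sum-level set is $$\mathcal{C}_n:=\Big\{[a_1,a_2,\ldots]\in[0,1]:\ \sum_{i=1}^{k}a_i=n\ \text{for some }k\in\mathbb{N}\Big\}.$$ *)

theory Defs
  imports "HOL-Analysis.Analysis"
begin

text \<open>Partial quotients are indexed from 1, as in \<open>[a\<^sub>1, a\<^sub>2, \<dots>]\<close>; the value \<open>a 0\<close> plays no role.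
  The function below gives the finite fraction \<open>[a\<^sub>1, \<dots>, a\<^sub>k]\<close>, which is 0 for \<open>k = 0\<close>.\<close>

primrec cf_convergent :: "nat \<Rightarrow> (nat \<Rightarrow> nat) \<Rightarrow> real" where
  "cf_convergent 0 a = 0"
| "cf_convergent (Suc k) a = 1 / (real (a 1) + cf_convergent k (\<lambda>i. a (Suc i)))"

text \<open>\<open>x = [a\<^sub>1, a\<^sub>2, \<dots>]\<close> with infinitely many entries: the infinite fraction is the limit of its
  convergents. Finite (rational) expansions are not included.\<close>

definition has_regular_cf :: "real \<Rightarrow> (nat \<Rightarrow> nat) \<Rightarrow> bool" where
  "has_regular_cf x a \<longleftrightarrow>
     (\<forall>i\<ge>1. a i > 0) \<and> (\<lambda>k. cf_convergent k a) \<longlonglongrightarrow> x"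

definition sum_level_set :: "nat \<Rightarrow> real set" where
  "sum_level_set n =
     {x \<in> {0..1}. \<exists>a. has_regular_cf x a \<and> (\<exists>k\<ge>1. (\<Sum>i=1..k. a i) = n)}"

end

theory Submission
  imports Defs
begin

text \<open>The Farey map sends \<open>x\<close> to \<open>x / (1 - x)\<close> on \<open>[0, 1/2]\<close> and to \<open>(1 - x) / x\<close> on \<open>[1/2, 1]\<close>.
  On continued fractions it lowers the first entry by 1, or deletes that entry if it equals 1; so it
  lowers all partial sums by 1, and the sum-level set for \<open>n + 1\<close> lies in the \<open>n\<close>-th preimage of
  \<open>[1/2, 1]\<close> (\<open>sum_level_set_subset\<close>). The Lebesgue measure of that preimage is the integral over
  \<open>[1/2, 1]\<close> of the \<open>n\<close>-th iterate \<open>f\<^sub>n\<close> of the constant 1 under the transfer operator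
  (\<open>integral_farey_preimage_iterate\<close>).

  The Farey map has the infinite invariant measure \<open>dx / x\<close>, and it is the infinite mass near 0 that
  forces \<open>f\<^sub>n\<close> to vanish away from 0. To see this, pass to the density \<open>h\<^sub>n(x) = x f\<^sub>n(x)\<close> with
  respect to \<open>dx / x\<close>. The transfer operator turns into the averaging operator
  \<open>h(x) \<mapsto> (h(x / (1 + x)) + x h(1 / (1 + x))) / (1 + x)\<close>, which preserves nonnegative increasing
  concave functions (\<open>increasing_concave_farey_average\<close>), and \<open>h\<^sub>0(x) = x\<close> is one. Hence \<open>h\<^sub>n(1)\<close> is the
  maximum of \<open>h\<^sub>n\<close>, and it decreases with \<open>n\<close>, because it is an average of earlier values; let
  \<open>c\<close> be its limit. As \<open>h\<^bsub>n+1\<^esub>(1 / k)\<close> is an average of \<open>h\<^sub>n(1 / (k + 1))\<close> and a second value of \<open>h\<^sub>n\<close>, and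
  neither can exceed \<open>h\<^sub>n(1)\<close>, induction on \<open>k\<close> gives \<open>h\<^sub>n(1 / k) \<longlonglongrightarrow> c\<close> for every \<open>k\<close>
  (\<open>farey_density_tendsto\<close>). But \<open>f\<^sub>n\<close> has total integral 1, while on \<open>[1 / k, 1]\<close> it is at least
  \<open>h\<^sub>n(1 / k) / x\<close>; so \<open>c ln k \<le> 1\<close> for all \<open>k\<close>, which leaves only \<open>c = 0\<close>. Finally the integral
  of \<open>f\<^sub>n\<close> over \<open>[1/2, 1]\<close> is at most \<open>h\<^sub>n(1)\<close>.\<close>

section \<open>The Farey map and its transfer operator\<close>

text \<open>The two functions are the inverse branches of the Farey map, so for \<open>E \<subseteq> [0, 1]\<close> this is the preimage
  of \<open>E\<close> under the map. Working with images of the branches avoids a definition of the map by cases and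
  keeps compact sets compact.\<close>

definition farey_preimage :: "real set \<Rightarrow> real set" where
  "farey_preimage E = (\<lambda>x. x / (1 + x)) ` E \<union> (\<lambda>x. 1 / (1 + x)) ` E"

text \<open>The factor \<open>1 / (1 + x)\<^sup>2\<close> is the absolute value of the derivative of either inverse branch.\<close>

definition farey_transfer :: "(real \<Rightarrow> real) \<Rightarrow> real \<Rightarrow> real" where
  "farey_transfer f x = (f (x / (1 + x)) + f (1 / (1 + x))) / (1 + x)\<^sup>2"

lemma farey_branch_in_unit:
  fixes x :: real
  assumes "x \<in> {0..1}"
  shows "x / (1 + x) \<in> {0..1}" "1 / (1 + x) \<in> {0..1}"
  using assms by (auto simp: field_simps)

lemma farey_branch_continuous:
  assumes "E \<subseteq> {0..1::real}"
  shows "continuous_on E (\<lambda>x. x / (1 + x))" "continuous_on E (\<lambda>x. 1 / (1 + x))"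
  using assms by (auto intro!: continuous_intros)

lemma farey_preimage_compact:
  assumes "compact E" "E \<subseteq> {0..1}"
  shows "compact (farey_preimage E)" "farey_preimage E \<subseteq> {0..1}"
proof -
  show "compact (farey_preimage E)"
    unfolding farey_preimage_def
    by (intro compact_Un compact_continuous_image farey_branch_continuous assms)
  show "farey_preimage E \<subseteq> {0..1}"
    unfolding farey_preimage_def using assms farey_branch_in_unit by blast
qed

lemma farey_preimage_unit: "farey_preimage {0..1} = {0..1}"
proof
  show "farey_preimage {0..1} \<subseteq> {0..1}"
    by (intro farey_preimage_compact) auto
  show "{0..1} \<subseteq> farey_preimage {0..1}"
  proof
    fix y :: real
    assume y: "y \<in> {0..1}"
    show "y \<in> farey_preimage {0..1}"
    proof (cases "y \<le> 1/2")
      case True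
      then have "y = (y / (1 - y)) / (1 + y / (1 - y))" "y / (1 - y) \<in> {0..1}"
        using y by (auto simp: field_simps)
      then show ?thesis
        unfolding farey_preimage_def by blast
    next
      case False
      then have "y = 1 / (1 + (1 / y - 1))" "1 / y - 1 \<in> {0..1}"
        using y by (auto simp: field_simps)
      then show ?thesis
        unfolding farey_preimage_def by blast
    qed
  qed
qed

lemma farey_transfer_continuous:
  assumes "continuous_on {0..1} f"
  shows "continuous_on {0..1} (farey_transfer f)"
proof -
  have "continuous_on {0..1} (\<lambda>x. f (x / (1 + x)))" "continuous_on {0..1} (\<lambda>x. f (1 / (1 + x)))"
    using farey_branch_in_unit
    by (auto intro!: continuous_on_compose2[OF assms] farey_branch_continuous simp del: atLeastAtMost_iff)
  then have "continuous_on {0..1} (\<lambda>x. (f (x / (1 + x)) + f (1 / (1 + x))) / (1 + x)\<^sup>2)"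
    by (intro continuous_intros) auto
  then show ?thesis
    unfolding farey_transfer_def[abs_def] .
qed

lemma continuous_absolutely_integrable_compact:
  fixes f :: "real \<Rightarrow> real"
  assumes "continuous_on {0..1} f" "compact E" "E \<subseteq> {0..1}"
  shows "f absolutely_integrable_on E"
  using assms
  by (meson absolutely_integrable_continuous_real lmeasurable_compact fmeasurableD set_integrable_subset)

text \<open>Change of variables on each inverse branch. The images of the branches lie on either side of
  \<open>1/2\<close>, so they overlap in at most one point and their integrals add up.\<close>

lemma integral_farey_preimage:
  assumes f: "continuous_on {0..1} f" and E: "compact E" "E \<subseteq> {0..1}"
  shows "integral (farey_preimage E) f = integral E (farey_transfer f)"
proof -
  let ?A = "(\<lambda>x. x / (1 + x)) ` E" and ?B = "(\<lambda>x. 1 / (1 + x)) ` E"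
  have leb: "E \<in> sets lebesgue"
    using E(1) lmeasurable_compact fmeasurableD by blast
  have pos: "x \<ge> 0" if "x \<in> E" for x
    using E(2) that by auto
  have sub: "?A \<subseteq> {0..1}" "?B \<subseteq> {0..1}"
    using E(2) farey_branch_in_unit by blast+
  have AB: "f absolutely_integrable_on ?A" "f absolutely_integrable_on ?B"
    using f E sub by (auto intro!: continuous_absolutely_integrable_compact compact_continuous_image farey_branch_continuous
        simp del: atLeastAtMost_iff)
  have "((\<lambda>x. x / (1 + x)) has_field_derivative 1 / (1 + x)\<^sup>2) (at x within E)" if "x \<in> E" for x
    using pos[OF that] by (auto intro!: derivative_eq_intros simp: divide_simps power2_eq_square)
  moreover have "inj_on (\<lambda>x. x / (1 + x)) E"
  proof (rule inj_onI)
    fix x y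
    assume xy: "x \<in> E" "y \<in> E" "x / (1 + x) = y / (1 + y)"
    then have "x * (1 + y) = y * (1 + x)"
      using pos[of x] pos[of y] by (subst (asm) frac_eq_eq) auto
    then show "x = y"
      by (simp add: algebra_simps)
  qed
  ultimately have A: "(\<lambda>x. \<bar>1 / (1 + x)\<^sup>2\<bar> * f (x / (1 + x))) absolutely_integrable_on E \<and>
      integral E (\<lambda>x. \<bar>1 / (1 + x)\<^sup>2\<bar> * f (x / (1 + x))) = integral ?A f"
    using has_absolute_integral_change_of_variables_1'[OF leb, of "\<lambda>x. x / (1 + x)" "\<lambda>x. 1 / (1 + x)\<^sup>2"] AB(1) by blast
  have "((\<lambda>x. 1 / (1 + x)) has_field_derivative - 1 / (1 + x)\<^sup>2) (at x within E)" if "x \<in> E" for x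
    using pos[OF that] by (auto intro!: derivative_eq_intros simp: divide_simps power2_eq_square)
  moreover have "inj_on (\<lambda>x. 1 / (1 + x)) E"
  proof (rule inj_onI)
    fix x y
    assume xy: "x \<in> E" "y \<in> E" "1 / (1 + x) = 1 / (1 + y)"
    then show "x = y"
      using pos[of x] pos[of y] by simp
  qed
  ultimately have B: "(\<lambda>x. \<bar>- 1 / (1 + x)\<^sup>2\<bar> * f (1 / (1 + x))) absolutely_integrable_on E \<and>
      integral E (\<lambda>x. \<bar>- 1 / (1 + x)\<^sup>2\<bar> * f (1 / (1 + x))) = integral ?B f"
    using has_absolute_integral_change_of_variables_1'[OF leb, of "\<lambda>x. 1 / (1 + x)" "\<lambda>x. - 1 / (1 + x)\<^sup>2"] AB(2) by blast
  have "x / (1 + x) \<le> 1/2" "1/2 \<le> 1 / (1 + x)" if "x \<in> E" for x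
    using E(2) that by (auto simp: field_simps)
  then have "?A \<subseteq> {..1/2}" "?B \<subseteq> {1/2..}"
    by blast+
  then have "?A \<inter> ?B \<subseteq> {1/2}"
    by force
  then have "negligible (?A \<inter> ?B)"
    using negligible_subset by blast
  then have "integral (farey_preimage E) f = integral ?A f + integral ?B f"
    unfolding farey_preimage_def using AB
    by (intro integral_Un) (auto simp: absolutely_integrable_on_def)
  also have "\<dots> = integral E (\<lambda>x. \<bar>1 / (1 + x)\<^sup>2\<bar> * f (x / (1 + x)) + \<bar>- 1 / (1 + x)\<^sup>2\<bar> * f (1 / (1 + x)))"
    using A B by (subst integral_add) (auto simp: absolutely_integrable_on_def)
  also have "\<dots> = integral E (farey_transfer f)"
    by (intro integral_cong) (auto simp: farey_transfer_def add_divide_distrib)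
  finally show ?thesis .
qed

lemma integral_farey_preimage_iterate:
  assumes "continuous_on {0..1} f" "compact E" "E \<subseteq> {0..1}"
  shows "integral ((farey_preimage ^^ n) E) f = integral E ((farey_transfer ^^ n) f)"
  using assms
proof (induction n arbitrary: E)
  case (Suc n)
  have "integral ((farey_preimage ^^ Suc n) E) f = integral (farey_preimage E) ((farey_transfer ^^ n) f)"
    unfolding funpow_Suc_right o_apply using Suc.prems farey_preimage_compact by (intro Suc.IH) auto
  moreover have "continuous_on {0..1} ((farey_transfer ^^ n) f)"
    by (induction n) (auto intro: farey_transfer_continuous Suc.prems)
  ultimately show ?case
    using Suc.prems by (simp add: integral_farey_preimage)
qed auto

section \<open>Sum-level sets are Farey preimages\<close>

lemma cf_convergent_in_unit:
  assumes "\<forall>i\<ge>1. a i > 0"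
  shows "cf_convergent k a \<in> {0..1}"
  using assms
proof (induction k arbitrary: a)
  case (Suc k)
  have "cf_convergent k (\<lambda>i. a (Suc i)) \<in> {0..1}"
    using Suc.prems by (intro Suc.IH) auto
  moreover have "real (a 1) \<ge> 1"
    using Suc.prems by (simp add: Suc_leI)
  ultimately show ?case
    by (auto simp: field_simps)
qed auto

lemma has_regular_cf_in_unit:
  assumes "has_regular_cf x a"
  shows "x \<in> {0..1}"
  using assms cf_convergent_in_unit[of a] closed_sequentially[of "{0..1}" "\<lambda>k. cf_convergent k a" x]
  unfolding has_regular_cf_def by auto

text \<open>The convergents of the tail are \<open>1 / c - a\<^sub>1\<close> for the convergents \<open>c\<close> of \<open>x\<close>. Since
  \<open>c \<ge> 1 / (a\<^sub>1 + 1)\<close>, the limit \<open>x\<close> is not 0 and the inversion passes to the limit.\<close>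

lemma has_regular_cf_tail:
  assumes "has_regular_cf x a"
  obtains y where "has_regular_cf y (\<lambda>i. a (Suc i))" "x = 1 / (real (a 1) + y)"
proof -
  let ?b = "\<lambda>i. a (Suc i)"
  have pos: "\<forall>i\<ge>1. a i > 0" "\<forall>i\<ge>1. ?b i > 0" and lim: "(\<lambda>k. cf_convergent k a) \<longlonglongrightarrow> x"
    using assms by (auto simp: has_regular_cf_def)
  have a1: "real (a 1) \<ge> 1"
    using pos by (simp add: Suc_leI)
  have bnd: "cf_convergent k ?b \<in> {0..1}" for k
    using cf_convergent_in_unit[OF pos(2)] .
  have lim': "(\<lambda>k. cf_convergent (Suc k) a) \<longlonglongrightarrow> x"
    using lim by (rule LIMSEQ_Suc)
  have "1 / (real (a 1) + 1) \<le> cf_convergent (Suc k) a" for k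
    using bnd[of k] a1 by (auto simp: field_simps)
  then have "1 / (real (a 1) + 1) \<le> x"
    using lim' by (intro LIMSEQ_le_const) auto
  then have "x > 0"
    using a1 by (smt (verit) zero_less_divide_iff)
  have "(\<lambda>k. 1 / cf_convergent (Suc k) a - real (a 1)) \<longlonglongrightarrow> 1 / x - real (a 1)"
    using \<open>x > 0\<close> by (intro tendsto_intros lim') auto
  moreover have "1 / cf_convergent (Suc k) a - real (a 1) = cf_convergent k ?b" for k
    using bnd[of k] a1 by auto
  ultimately have "has_regular_cf (1 / x - real (a 1)) ?b"
    using pos by (simp add: has_regular_cf_def)
  moreover have "x = 1 / (real (a 1) + (1 / x - real (a 1)))"
    using \<open>x > 0\<close> by auto
  ultimately show thesis
    using that by blast
qed

lemma cf_convergent_cong: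
  assumes "\<And>i. i \<ge> 1 \<Longrightarrow> a i = b i"
  shows "cf_convergent k a = cf_convergent k b"
  using assms
proof (induction k arbitrary: a b)
  case (Suc k)
  have "cf_convergent k (\<lambda>i. a (Suc i)) = cf_convergent k (\<lambda>i. b (Suc i))"
    using Suc.prems by (intro Suc.IH) auto
  then show ?case
    using Suc.prems[of 1] by simp
qed auto

lemma has_regular_cf_cons:
  assumes y: "has_regular_cf y (\<lambda>i. a (Suc i))" and a1: "a 1 > 0"
  shows "has_regular_cf (1 / (real (a 1) + y)) a"
proof -
  have "real (a 1) + y \<noteq> 0"
    using a1 has_regular_cf_in_unit[OF y] by auto
  then have "(\<lambda>k. cf_convergent (Suc k) a) \<longlonglongrightarrow> 1 / (real (a 1) + y)"
    unfolding cf_convergent.simps using y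
    by (intro tendsto_intros) (auto simp: has_regular_cf_def)
  moreover have "a i > 0" if "i \<ge> 1" for i
    using that y a1 by (cases "i = 1") (auto simp: has_regular_cf_def dest: spec[of _ "i - 1"])
  ultimately show ?thesis
    unfolding has_regular_cf_def using filterlim_sequentially_Suc[of "\<lambda>k. cf_convergent k a"] by blast
qed

text \<open>If \<open>a\<^sub>1 = 1\<close>, then \<open>x = 1 / (1 + y)\<close> for the tail \<open>y\<close>, whose partial sums are smaller by 1. If
  \<open>a\<^sub>1 > 1\<close>, then \<open>x = z / (1 + z)\<close>, where \<open>z\<close> has the same expansion with \<open>a\<^sub>1\<close> lowered by 1. The case
  \<open>n = 0\<close> is excluded because after the deletion of \<open>a\<^sub>1 = 1\<close> only the empty sum may remain.\<close>

lemma sum_level_set_Suc_subset: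
  assumes "n \<ge> 1"
  shows "sum_level_set (Suc n) \<subseteq> farey_preimage (sum_level_set n)"
proof
  fix x
  assume "x \<in> sum_level_set (Suc n)"
  then obtain a k where xa: "has_regular_cf x a" and k: "k \<ge> 1" "(\<Sum>i=1..k. a i) = Suc n"
    by (auto simp: sum_level_set_def)
  obtain y where y: "has_regular_cf y (\<lambda>i. a (Suc i))" and x: "x = 1 / (real (a 1) + y)"
    using has_regular_cf_tail[OF xa] .
  have y01: "y \<in> {0..1}"
    using has_regular_cf_in_unit[OF y] .
  have a1: "a 1 > 0"
    using xa by (auto simp: has_regular_cf_def)
  obtain m where m: "k = Suc m"
    using k(1) by (cases k) auto
  have sum_split: "(\<Sum>i=1..Suc m. b i) = b 1 + (\<Sum>i=1..m. b (Suc i))" for b :: "nat \<Rightarrow> nat"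
    using sum.atLeast_Suc_atMost[of 1 "Suc m" b] by (simp add: sum.shift_bounds_cl_Suc_ivl del: sum.cl_ivl_Suc)
  show "x \<in> farey_preimage (sum_level_set n)"
  proof (cases "a 1 = 1")
    case True
    then have s: "(\<Sum>i=1..m. a (Suc i)) = n"
      using k(2) m sum_split[of a] by simp
    moreover have "m \<ge> 1"
      using s assms by (cases m) auto
    ultimately have "y \<in> sum_level_set n"
      unfolding sum_level_set_def using y y01 by blast
    then show ?thesis
      using x True by (auto simp: farey_preimage_def)
  next
    case False
    define b where "b = a(1 := a 1 - 1)"
    define z where "z = 1 / (real (b 1) + y)"
    have b1: "b 1 > 0" "real (a 1) = real (b 1) + 1"
      using a1 False by (auto simp: b_def)
    have bS: "b (Suc i) = a (Suc i)" if "i \<ge> 1" for i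
      using that by (simp add: b_def)
    have "has_regular_cf y (\<lambda>i. b (Suc i))"
      using y bS cf_convergent_cong[of "\<lambda>i. b (Suc i)" "\<lambda>i. a (Suc i)"]
      by (simp add: has_regular_cf_def)
    then have z: "has_regular_cf z b"
      unfolding z_def using b1 by (intro has_regular_cf_cons)
    have "(\<Sum>i=1..m. b (Suc i)) = (\<Sum>i=1..m. a (Suc i))"
      using bS by (intro sum.cong) auto
    then have "(\<Sum>i=1..k. b i) = n"
      using k(2) m sum_split[of a] sum_split[of b] b1 by simp
    then have "z \<in> sum_level_set n"
      unfolding sum_level_set_def using z k(1) has_regular_cf_in_unit[OF z] by blast
    moreover have "x = z / (1 + z)"
      unfolding x z_def using b1 y01 by (auto simp: field_simps)
    ultimately show ?thesis
      by (auto simp: farey_preimage_def)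
  qed
qed

lemma sum_level_set_1_subset: "sum_level_set 1 \<subseteq> {1/2..1}"
proof
  fix x
  assume "x \<in> sum_level_set 1"
  then obtain a k where xa: "has_regular_cf x a" and k: "k \<ge> 1" "(\<Sum>i=1..k. a i) = 1"
    by (auto simp: sum_level_set_def)
  have "a 1 \<le> 1"
    using member_le_sum[of 1 "{1..k}" a] k by auto
  moreover have "a 1 > 0"
    using xa by (auto simp: has_regular_cf_def)
  ultimately have "a 1 = 1"
    by linarith
  obtain y where y: "has_regular_cf y (\<lambda>i. a (Suc i))" "x = 1 / (real (a 1) + y)"
    using has_regular_cf_tail[OF xa] .
  from has_regular_cf_in_unit[OF y(1)] show "x \<in> {1/2..1}"
    unfolding y(2) \<open>a 1 = 1\<close> by (auto simp: field_simps)
qed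

lemma farey_preimage_mono: "A \<subseteq> B \<Longrightarrow> farey_preimage A \<subseteq> farey_preimage B"
  by (auto simp: farey_preimage_def)

lemma sum_level_set_subset: "sum_level_set (Suc n) \<subseteq> (farey_preimage ^^ n) {1/2..1}"
proof (induction n)
  case 0
  then show ?case
    using sum_level_set_1_subset by simp
next
  case (Suc n)
  have "sum_level_set (Suc (Suc n)) \<subseteq> farey_preimage (sum_level_set (Suc n))"
    by (intro sum_level_set_Suc_subset) auto
  also have "\<dots> \<subseteq> farey_preimage ((farey_preimage ^^ n) {1/2..1})"
    by (intro farey_preimage_mono Suc.IH)
  finally show ?case
    by simp
qed

lemma measure_sum_level_set_le:
  "measure (lebesgue_on {0..1}) (sum_level_set (Suc n))
     \<le> integral {1/2..1} ((farey_transfer ^^ n) (\<lambda>_. 1))"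
proof -
  let ?E = "(farey_preimage ^^ n) {1/2..1}"
  have E: "compact ?E \<and> ?E \<subseteq> {0..1}"
  proof (induction n)
    case (Suc n)
    then show ?case
      by (simp add: farey_preimage_compact)
  qed auto
  then have leb: "?E \<in> lmeasurable"
    using lmeasurable_compact by blast
  interpret finite_measure "lebesgue_on {0..1::real}"
    by (rule finite_measure_lebesgue_on) auto
  have "measure (lebesgue_on {0..1}) (sum_level_set (Suc n)) \<le> measure (lebesgue_on {0..1}) ?E"
    using E leb sum_level_set_subset
    by (intro finite_measure_mono) (auto simp: sets_restrict_space_iff)
  also have "\<dots> = measure lebesgue ?E"
    using E by (intro measure_restrict_space) auto
  also have "\<dots> = integral ?E (\<lambda>_. 1)"
    using lmeasure_integral[OF leb] .
  also have "\<dots> = integral {1/2..1} ((farey_transfer ^^ n) (\<lambda>_. 1))"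
    by (intro integral_farey_preimage_iterate) auto
  finally show ?thesis .
qed

section \<open>Monotone concave densities relative to the invariant measure\<close>

text \<open>The transfer operator acting on densities with respect to the invariant measure \<open>dx / x\<close>. That
  this measure is invariant appears in the weights \<open>1 / (1 + x)\<close> and \<open>x / (1 + x)\<close>, whose sum is 1.\<close>

definition farey_average :: "(real \<Rightarrow> real) \<Rightarrow> real \<Rightarrow> real" where
  "farey_average h x = (h (x / (1 + x)) + x * h (1 / (1 + x))) / (1 + x)"

lemma farey_average_transfer:
  "x * farey_transfer f x = farey_average (\<lambda>x. x * f x) x"
proof -
  have "x * ((a + b) / (1 + x)\<^sup>2) = (x / (1 + x) * a + x * (1 / (1 + x) * b)) / (1 + x)" for a b
    by (simp add: power2_eq_square add_divide_distrib distrib_left)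
  then show ?thesis
    by (simp only: farey_transfer_def farey_average_def)
qed

definition increasing_concave :: "(real \<Rightarrow> real) \<Rightarrow> bool" where
  "increasing_concave h \<longleftrightarrow>
     mono_on {0..1} h \<and> concave_on {0..1} h \<and> (\<forall>x\<in>{0..1}. h x \<ge> 0)"

text \<open>Both \<open>z\<close> and \<open>1 - z\<close> lie between \<open>y\<close> and \<open>1 - y\<close>, with complementary barycentric weights; adding the
  two concavity inequalities gives \<open>h z + h (1 - z) \<ge> h y + h (1 - y)\<close>.\<close>

lemma concave_on_increment_antimono:
  fixes h :: "real \<Rightarrow> real"
  assumes h: "concave_on {0..1} h" and "0 \<le> y" "y \<le> z" "z \<le> 1/2"
  shows "h (1 - y) - h (1 - z) \<le> h z - h y"
proof (cases "y = z")
  case False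
  define t where "t = (z - y) / (1 - 2 * y)"
  have d: "1 - 2 * y > 0"
    using assms False by auto
  have t: "0 \<le> t" "t \<le> 1"
    using assms d by (auto simp: t_def field_simps)
  have e: "t * (1 - 2 * y) = z - y"
    using d by (simp add: t_def)
  have "(1 - t) * y + t * (1 - y) = z" "(1 - (1 - t)) * y + (1 - t) * (1 - y) = 1 - z"
    using e by (auto simp: algebra_simps)
  then have "h z \<ge> (1 - t) * h y + t * h (1 - y)"
      "h (1 - z) \<ge> (1 - (1 - t)) * h y + (1 - t) * h (1 - y)"
    using concave_onD[OF h, of t y "1 - y"] concave_onD[OF h, of "1 - t" y "1 - y"] t assms by auto
  then show ?thesis
    by (simp add: algebra_simps)
qed auto

text \<open>In the coordinate \<open>y = x / (1 + x)\<close>, in which \<open>1 / (1 + x) = 1 - y\<close>, the averaging operator takes this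
  form. Concavity holds because each summand is a product of two nonnegative concave functions, one
  increasing and the other decreasing. For monotonicity, the growth of the first summand has to
  outweigh the decrease of \<open>h (1 - y)\<close>; concavity of \<open>h\<close> provides this, since \<open>y \<le> 1 - y\<close>.\<close>

lemma increasing_concave_symmetrize:
  assumes "increasing_concave h"
  defines "g \<equiv> \<lambda>y. (1 - y) * h y + y * h (1 - y)"
  shows "mono_on {0..1/2} g" "concave_on {0..1/2} g"
proof -
  have mono: "mono_on {0..1} h" and conc: "concave_on {0..1} h" and nn: "\<And>x. x \<in> {0..1} \<Longrightarrow> h x \<ge> 0"
    using assms by (auto simp: increasing_concave_def)
  show "mono_on {0..1/2} g"
  proof (rule mono_onI)
    fix y z :: real
    assume yz: "y \<in> {0..1/2}" "z \<in> {0..1/2}" "y \<le> z"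
    have inc: "h (1 - y) - h (1 - z) \<le> h z - h y"
      using yz by (intro concave_on_increment_antimono[OF conc]) auto
    have le: "h y \<le> h z" "h (1 - z) \<le> h (1 - y)" "h y \<le> h (1 - y)"
      using yz by (auto intro!: mono_onD[OF mono])
    have "z * (h (1 - y) - h (1 - z)) \<le> (1 - z) * (h z - h y)"
      using yz le inc by (intro mult_mono) auto
    moreover have "(z - y) * (h (1 - y) - h y) \<ge> 0"
      using yz le by simp
    moreover have "g z - g y = (1 - z) * (h z - h y) - z * (h (1 - y) - h (1 - z))
        + (z - y) * (h (1 - y) - h y)"
      by (simp add: g_def algebra_simps)
    ultimately show "g y \<le> g z"
      by linarith
  qed
  have sub: "{0..1/2} \<subseteq> {0..1::real}"
    by auto
  have h1: "concave_on {0..1/2} h" "mono_on {0..1/2} h"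
    using conc mono sub by (auto simp: concave_on_def intro: convex_on_subset mono_on_subset)
  have h2: "concave_on {0..1/2} (\<lambda>y. h (1 - y))"
  proof (rule concave_on_linorderI)
    fix t x y :: real
    assume "0 < t" "t < 1" "x \<in> {0..1/2}" "y \<in> {0..1/2}" "x < y"
    then show "(1 - t) * h (1 - x) + t * h (1 - y) \<le> h (1 - ((1 - t) *\<^sub>R x + t *\<^sub>R y))"
      using concave_onD[OF conc, of t "1 - x" "1 - y"] by (auto simp: algebra_simps)
  qed auto
  have h3: "antimono_on {0..1/2} (\<lambda>y. h (1 - y))"
    by (auto intro!: monotone_onI mono_onD[OF mono])
  have "concave_on {0..1/2} (\<lambda>y. h y * (1 - y))"
    by (rule concave_on_mul[OF h1(1) _ h1(2)])
       (use nn in \<open>auto intro!: monotone_onI concave_on_diff simp: concave_on_const convex_on_ident\<close>)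
  moreover have "concave_on {0..1/2} (\<lambda>y. y * h (1 - y))"
    by (rule concave_on_mul[OF _ h2 _ h3])
       (use nn in \<open>auto intro!: mono_onI simp: concave_on_ident\<close>)
  ultimately show "concave_on {0..1/2} g"
    unfolding g_def using concave_on_add by (fastforce simp: mult.commute)
qed

text \<open>An increasing concave function composed with the increasing concave map \<open>x / (1 + x)\<close> is again
  increasing and concave.\<close>

lemma increasing_concave_farey_average:
  assumes h: "increasing_concave h"
  shows "increasing_concave (farey_average h)"
proof -
  define g where "g y = (1 - y) * h y + y * h (1 - y)" for y
  define u where "u x = x / (1 + x)" for x :: real
  have g: "mono_on {0..1/2} g" "concave_on {0..1/2} g"
    using increasing_concave_symmetrize[OF h] unfolding g_def[abs_def] by auto
  have eq: "farey_average h x = g (u x)" if "x \<in> {0..1}" for x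
  proof -
    have "1 - u x = 1 / (1 + x)"
      using that by (auto simp: u_def field_simps)
    then show ?thesis
      by (simp add: g_def farey_average_def u_def add_divide_distrib)
  qed
  have u: "u x \<in> {0..1/2}" if "x \<in> {0..1}" for x
    using that by (auto simp: u_def field_simps)
  have u_mono: "u x \<le> u y" if "0 \<le> x" "x \<le> y" for x y
    using that by (auto simp: u_def field_simps)
  have u_conc: "(1 - t) * u x + t * u y \<le> u ((1 - t) * x + t * y)"
    if t: "0 \<le> t" "t \<le> 1" and x: "0 \<le> x" and y: "0 \<le> y" for t x y
  proof -
    have "inverse ((1 - t) * (1 + x) + t * (1 + y)) \<le> (1 - t) * inverse (1 + x) + t * inverse (1 + y)"
      using convex_onD[OF convex_on_inverse[of "{0<..}"], of t "1 + x" "1 + y"] t x y by auto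
    moreover have "(1 - t) * (1 + x) + t * (1 + y) = 1 + ((1 - t) * x + t * y)"
      by (simp add: algebra_simps)
    moreover have u_eq: "u z = 1 - inverse (1 + z)" if "z \<ge> 0" for z
      using that by (simp add: u_def field_simps)
    have "(1 - t) * x + t * y \<ge> 0"
      using t x y by simp
    ultimately show ?thesis
      using x y by (simp add: u_eq algebra_simps)
  qed
  have "mono_on {0..1} (farey_average h)"
    by (rule mono_onI) (use eq u u_mono mono_onD[OF g(1)] in auto)
  moreover have "concave_on {0..1} (farey_average h)"
  proof (rule concave_on_linorderI)
    fix t x y :: real
    assume *: "0 < t" "t < 1" "x \<in> {0..1}" "y \<in> {0..1}" "x < y"
    have m: "(1 - t) * x + t * y \<in> {0..1}"
      using * convexD_alt[of "{0..1::real}" x y t] by auto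
    have um: "(1 - t) * u x + t * u y \<in> {0..1/2}"
      using * u[of x] u[of y] convexD_alt[of "{0..1/2::real}" "u x" "u y" t] by auto
    have "(1 - t) * g (u x) + t * g (u y) \<le> g ((1 - t) * u x + t * u y)"
      using concave_onD[OF g(2), of t "u x" "u y"] * u by auto
    also have "\<dots> \<le> g (u ((1 - t) * x + t * y))"
      using * by (intro mono_onD[OF g(1)] um u m u_conc) auto
    finally show "(1 - t) * farey_average h x + t * farey_average h y
        \<le> farey_average h ((1 - t) *\<^sub>R x + t *\<^sub>R y)"
      using * m by (simp add: eq del: atLeastAtMost_iff)
  qed auto
  moreover have "farey_average h x \<ge> 0" if "x \<in> {0..1}" for x
  proof -
    have "h (x / (1 + x)) \<ge> 0" "h (1 / (1 + x)) \<ge> 0"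
      using h farey_branch_in_unit[OF that] unfolding increasing_concave_def by blast+
    then show ?thesis
      using that by (simp add: farey_average_def)
  qed
  ultimately show ?thesis
    by (simp add: increasing_concave_def)
qed

text \<open>The density, with respect to \<open>dx / x\<close>, of the image of Lebesgue measure under \<open>n\<close> steps of the
  Farey map.\<close>

definition farey_density :: "nat \<Rightarrow> real \<Rightarrow> real" where
  "farey_density n x = x * (farey_transfer ^^ n) (\<lambda>_. 1) x"

lemma farey_density_Suc: "farey_density (Suc n) = farey_average (farey_density n)"
  by (rule ext) (simp add: farey_density_def[abs_def] farey_average_transfer)

lemma increasing_concave_farey_density: "increasing_concave (farey_density n)"
proof (induction n)
  case 0
  have "mono_on {0..1} (\<lambda>x::real. x)" "concave_on {0..1} (\<lambda>x::real. x)"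
    by (auto intro: mono_onI simp: concave_on_ident)
  then show ?case
    by (simp add: increasing_concave_def farey_density_def[abs_def])
next
  case (Suc n)
  then show ?case
    by (simp add: farey_density_Suc increasing_concave_farey_average)
qed

lemma farey_density_mono:
  assumes "0 \<le> x" "x \<le> y" "y \<le> 1"
  shows "farey_density n x \<le> farey_density n y"
  using increasing_concave_farey_density[of n] assms
  by (auto simp: increasing_concave_def intro: mono_onD)

lemma farey_density_nonneg:
  assumes "0 \<le> x" "x \<le> 1"
  shows "farey_density n x \<ge> 0"
  using increasing_concave_farey_density[of n] assms by (auto simp: increasing_concave_def)

text \<open>Both inverse branches send 1 to \<open>1/2\<close>, so the averaging operator replaces the value at 1 by the
  value at \<open>1/2\<close>, which is no larger.\<close>

lemma farey_density_at_1_convergent: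
  obtains c where "c \<ge> 0" "(\<lambda>n. farey_density n 1) \<longlonglongrightarrow> c"
proof -
  have "farey_density (Suc n) 1 \<le> farey_density n 1" for n
    using farey_density_mono[of "1/2" 1 n] by (simp add: farey_density_Suc farey_average_def)
  then have "decseq (\<lambda>n. farey_density n 1)"
    by (rule decseq_SucI)
  then obtain c where "(\<lambda>n. farey_density n 1) \<longlonglongrightarrow> c" "\<forall>n. c \<le> farey_density n 1"
    using decseq_convergent[of "\<lambda>n. farey_density n 1" 0] farey_density_nonneg[of 1] by auto
  moreover from this have "c \<ge> 0"
    using farey_density_nonneg[of 1] by (intro LIMSEQ_le_const[of _ c 0]) auto
  ultimately show thesis
    using that by blast
qed

text \<open>An average that tends to \<open>c\<close> and whose terms are asymptotically at most \<open>c\<close> has all its terms with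
  constant positive weight tending to \<open>c\<close>. The averaging operator at \<open>1 / d\<close> involves the value at
  \<open>1 / (d + 1)\<close> with weight \<open>d / (d + 1)\<close>, which drives an induction from 1 through all the points \<open>1 / d\<close>.\<close>

lemma farey_density_tendsto:
  assumes c: "(\<lambda>n. farey_density n 1) \<longlonglongrightarrow> c"
  shows "(\<lambda>n. farey_density n (1 / real (Suc k))) \<longlonglongrightarrow> c"
proof (induction k)
  case 0
  then show ?case
    using c by simp
next
  case (Suc k)
  define d where "d = real (Suc k)"
  have d: "d \<ge> 1" "real (Suc (Suc k)) = d + 1"
    by (auto simp: d_def)
  have lower: "(1 + 1 / d) * farey_density (Suc n) (1 / d) - 1 / d * farey_density n 1
      \<le> farey_density n (1 / (d + 1))" for n
  proof -
    have "1 / d / (1 + 1 / d) = 1 / (d + 1)" "1 / (1 + 1 / d) = d / (d + 1)"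
      using d by (auto simp: field_simps)
    then have "(1 + 1 / d) * farey_density (Suc n) (1 / d)
        = farey_density n (1 / (d + 1)) + 1 / d * farey_density n (d / (d + 1))"
      using d by (simp add: farey_density_Suc farey_average_def add_pos_pos less_imp_neq[symmetric])
    moreover have "1 / d * farey_density n (d / (d + 1)) \<le> 1 / d * farey_density n 1"
      using d by (intro mult_left_mono farey_density_mono) auto
    ultimately show ?thesis
      by linarith
  qed
  have upper: "farey_density n (1 / (d + 1)) \<le> farey_density n 1" for n
    using d by (intro farey_density_mono) auto
  have "(\<lambda>n. farey_density (Suc n) (1 / d)) \<longlonglongrightarrow> c"
    using Suc.IH unfolding d_def by (rule LIMSEQ_Suc)
  then have "(\<lambda>n. (1 + 1 / d) * farey_density (Suc n) (1 / d) - 1 / d * farey_density n 1)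
      \<longlonglongrightarrow> (1 + 1 / d) * c - 1 / d * c"
    by (intro tendsto_intros c)
  also have "(1 + 1 / d) * c - 1 / d * c = c"
    by (simp add: algebra_simps)
  finally show ?case
    unfolding d(2) using lower upper c
    by (intro tendsto_sandwich[of "\<lambda>n. (1 + 1 / d) * farey_density (Suc n) (1 / d) - 1 / d * farey_density n 1"
          "\<lambda>n. farey_density n (1 / (d + 1))" _ "\<lambda>n. farey_density n 1"] always_eventually) auto
qed

lemma farey_transfer_iterate_continuous:
  "continuous_on {0..1} ((farey_transfer ^^ n) (\<lambda>_. 1))"
  by (induction n) (auto intro: farey_transfer_continuous)

lemma farey_transfer_iterate_nonneg:
  assumes "0 \<le> x" "x \<le> 1"
  shows "(farey_transfer ^^ n) (\<lambda>_. 1) x \<ge> 0"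
  using assms
proof (induction n arbitrary: x)
  case (Suc n)
  then show ?case
    using farey_branch_in_unit[of x] by (simp add: farey_transfer_def)
qed auto

text \<open>The total mass 1 bounds the mass of \<open>[1 / d, 1]\<close>, on which the density with respect to \<open>dx / x\<close> is at least its
  value at the left end; and \<open>dx / x\<close> gives this interval the mass \<open>ln d\<close>.\<close>

lemma farey_density_log_bound: "farey_density n (1 / real (Suc k)) * ln (real (Suc k)) \<le> 1"
proof -
  define d where "d = real (Suc k)"
  define f where "f = (farey_transfer ^^ n) (\<lambda>_. 1)"
  have d: "d \<ge> 1"
    by (simp add: d_def)
  have cont: "continuous_on {0..1} f"
    unfolding f_def by (rule farey_transfer_iterate_continuous)
  have int: "f integrable_on {1/d..1}"
    using d by (intro integrable_continuous_real continuous_on_subset[OF cont]) auto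
  have "((\<lambda>x. 1 / x) has_integral (ln 1 - ln (1 / d))) {1/d..1}"
    using d by (intro fundamental_theorem_of_calculus)
      (auto intro!: derivative_eq_intros simp flip: has_real_derivative_iff_has_vector_derivative
         intro: less_le_trans[of 0 "1 / d"])
  then have "((\<lambda>x. farey_density n (1/d) * (1 / x)) has_integral
      farey_density n (1/d) * (ln 1 - ln (1 / d))) {1/d..1}"
    by (rule has_integral_mult_right)
  then have "farey_density n (1/d) * ln d \<le> integral {1/d..1} f"
  proof (rule has_integral_le[OF _ integrable_integral[OF int], THEN order_trans[rotated]])
    show "farey_density n (1/d) * ln d \<le> farey_density n (1/d) * (ln 1 - ln (1 / d))"
      using d by (simp add: ln_div)
  next
    fix x
    assume x: "x \<in> {1/d..1}"
    then have "x > 0"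
      using d by (auto intro: less_le_trans[of 0 "1 / d"])
    moreover have "farey_density n (1/d) \<le> x * f x"
      using farey_density_mono[of "1/d" x n] x d by (simp add: farey_density_def f_def)
    ultimately show "farey_density n (1/d) * (1 / x) \<le> f x"
      by (simp add: field_simps)
  qed
  also have "\<dots> \<le> integral {0..1} f"
    using d farey_transfer_iterate_nonneg
    by (intro integral_subset_le int integrable_continuous_real cont) (auto simp: f_def)
  also have "\<dots> = 1"
  proof -
    have "(farey_preimage ^^ n) {0..1} = {0..1}"
      by (induction n) (simp_all add: farey_preimage_unit)
    then show ?thesis
      using integral_farey_preimage_iterate[of "\<lambda>_. 1" "{0..1}" n] by (simp add: f_def)
  qed
  finally show ?thesis
    by (simp only: d_def)
qed

text \<open>A positive limit would contradict the logarithmic bound, because \<open>ln\<close> is unbounded.\<close>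

lemma farey_density_at_1_tendsto_0: "(\<lambda>n. farey_density n 1) \<longlonglongrightarrow> 0"
proof -
  obtain c where c: "c \<ge> 0" "(\<lambda>n. farey_density n 1) \<longlonglongrightarrow> c"
    using farey_density_at_1_convergent .
  have bound: "c * ln (real (Suc k)) \<le> 1" for k
    using farey_density_log_bound
    by (intro LIMSEQ_le_const2[OF tendsto_mult_right[OF farey_density_tendsto[OF c(2), of k]]]) auto
  have "c = 0"
  proof (rule ccontr)
    assume "c \<noteq> 0"
    then have "c > 0"
      using c by simp
    obtain k where "exp (1 / c) < real k"
      using reals_Archimedean2 by blast
    then have "exp (1 / c) < real (Suc k)"
      by simp
    then have "1 / c < ln (real (Suc k))"
      by (metis exp_gt_zero ln_exp ln_less_cancel_iff of_nat_0_less_iff zero_less_Suc)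
    then show False
      using bound[of k] \<open>c > 0\<close> by (simp add: field_simps)
  qed
  then show ?thesis
    using c by simp
qed

lemma integral_farey_transfer_iterate_le:
  "integral {1/2..1} ((farey_transfer ^^ n) (\<lambda>_. 1)) \<le> farey_density n 1"
proof -
  let ?f = "(farey_transfer ^^ n) (\<lambda>_. 1)"
  have "?f x \<le> 2 * farey_density n 1" if "x \<in> {1/2..1}" for x
  proof -
    have "?f x = farey_density n x / x"
      using that by (auto simp: farey_density_def)
    also have "\<dots> \<le> farey_density n 1 / (1/2)"
      using that by (intro frac_le farey_density_mono farey_density_nonneg) auto
    finally show ?thesis
      by simp
  qed
  then have "integral {1/2..1} ?f \<le> integral {1/2..1::real} (\<lambda>_. 2 * farey_density n 1)"
    by (intro integral_le integrable_continuous_real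
        continuous_on_subset[OF farey_transfer_iterate_continuous]) auto
  then show ?thesis
    by simp
qed

theorem theorem1p1:
  "(\<lambda>n. measure (lebesgue_on {0..1}) (sum_level_set n)) \<longlonglongrightarrow> 0"
proof -
  have "measure (lebesgue_on {0..1}) (sum_level_set (Suc n)) \<le> farey_density n 1" for n
    using measure_sum_level_set_le integral_farey_transfer_iterate_le by (rule order_trans)
  then have "(\<lambda>n. measure (lebesgue_on {0..1}) (sum_level_set (Suc n))) \<longlonglongrightarrow> 0"
    by (intro tendsto_sandwich[OF _ _ tendsto_const farey_density_at_1_tendsto_0]) auto
  then show ?thesis
    by (rule LIMSEQ_imp_Suc)
qed

end
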